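(* Let $0 < e_1 < e_2 < 1$, let $U_1\equiv\langle T_1,e_1,S_1\rangle$ be a uninorm, and let $U_2\equiv\langle T_2,e_2,\max\rangle$ be a uninorm that is locally internal on $A(e_2)$. Then $U_1$ is distributive over $U_2$ if and only if the following three conditions all hold: (i) $U_1(x, y) = U_2(x, y) \in \{x, y\}$ for any $x \in\, ]e_2,1]$ and $y \in [0, e_2]$; and, in particular, $U_2(y_0,y_0)=y_0$ whenever $U_2(x_0,y_0)=y_0$ for some $x_0 \in\, ]e_2,1]$ and $y_0 \in [0,e_1]$. (ii) $U_1(x, y) = U_2(x, y) = \max(x, y)$ for any $x \in \,]e_2,1]$ and $y \in [e_1, e_2]$. (iii) There exists a uninorm $\widehat{U}$ with neutral element $\frac{e_1}{e_2}$ such that $$U_1(x,y) = e_2\, \widehat{U}\left (\frac{x }{ e_2}, \frac{y }{ e_2}\right)$$ for any $x, y \in [0,e_2]$, and $\widehat{U}$ is distributive over $T_2$.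
   Context: A uninorm is a binary operation $U:[0,1]^2\to[0,1]$ that is commutative, associative, increasing (non-decreasing) in each variable with respect to the usual order, and has a neutral element $e\in[0,1]$. A uninorm is a t-norm if $e=1$ and a t-conorm if $e=0$. For $e\in\,]0,1[$, the notation $U\equiv\langle T,e,S\rangle$ means that $U$ is a uninorm with neutral element $e$, underlying t-norm $T$ and underlying t-conorm $S$, i.e. $T,S:[0,1]^2\to[0,1]$ are the t-norm and t-conorm with $U(x,y)=e\,T\left(\frac{x}{e},\frac{y}{e}\right)$ for $x,y\in[0,e]$ and $U(x,y)=e+(1-e)\,S\left(\frac{x-e}{1-e},\frac{y-e}{1-e}\right)$ for $x,y\in[e,1]$. $A(e)=[0,1]^2\setminus([0,e]^2\cup[e,1]^2)$. A uninorm $U$ with neutral element $e$ is locally internal on $A(e)$ if $U(x,y)\in\{x,y\}$ for all $(x,y)\in A(e)$. A uninorm $V_1$ is distributive over a uninorm $V_2$ (t-norms and t-conorms being included among uninorms) if $V_1(x,V_2(y,z))=V_2(V_1(x,y),V_1(x,z))$ for all $x,y,z\in[0,1]$. $[a,b[$ and $]a,b]$ denote half-open intervals, and $]a,b[$ denotes the open interval. *)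

theory Defs
  imports Complex_Main
begin

text \<open>
  A binary operation on the unit interval is a function on all reals whose values
  are only ever considered on \<open>[0,1]\<close>; its values elsewhere are arbitrary.
\<close>

definition uninorm :: "real \<Rightarrow> (real \<Rightarrow> real \<Rightarrow> real) \<Rightarrow> bool" where
  "uninorm e U \<longleftrightarrow>
     (\<forall>x\<in>{0..1}. \<forall>y\<in>{0..1}. U x y \<in> {0..1}) \<and>
     (\<forall>x\<in>{0..1}. \<forall>y\<in>{0..1}. U x y = U y x) \<and>
     (\<forall>x\<in>{0..1}. \<forall>y\<in>{0..1}. \<forall>z\<in>{0..1}. U (U x y) z = U x (U y z)) \<and>
     (\<forall>x\<in>{0..1}. \<forall>x'\<in>{0..1}. \<forall>y\<in>{0..1}. x \<le> x' \<longrightarrow> U x y \<le> U x' y) \<and>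
     (\<forall>x\<in>{0..1}. \<forall>y\<in>{0..1}. \<forall>y'\<in>{0..1}. y \<le> y' \<longrightarrow> U x y \<le> U x y') \<and>
     e \<in> {0..1} \<and>
     (\<forall>x\<in>{0..1}. U e x = x \<and> U x e = x)"

definition t_norm :: "(real \<Rightarrow> real \<Rightarrow> real) \<Rightarrow> bool" where
  "t_norm T \<longleftrightarrow> uninorm 1 T"

definition t_conorm :: "(real \<Rightarrow> real \<Rightarrow> real) \<Rightarrow> bool" where
  "t_conorm S \<longleftrightarrow> uninorm 0 S"

text \<open>The relation \<open>U \<equiv> \<langle>T, e, S\<rangle>\<close>.\<close>

definition uninorm_with ::
  "(real \<Rightarrow> real \<Rightarrow> real) \<Rightarrow> (real \<Rightarrow> real \<Rightarrow> real) \<Rightarrow> real \<Rightarrow> (real \<Rightarrow> real \<Rightarrow> real) \<Rightarrow> bool" where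
  "uninorm_with U T e S \<longleftrightarrow>
     0 < e \<and> e < 1 \<and> uninorm e U \<and> t_norm T \<and> t_conorm S \<and>
     (\<forall>x\<in>{0..e}. \<forall>y\<in>{0..e}. U x y = e * T (x / e) (y / e)) \<and>
     (\<forall>x\<in>{e..1}. \<forall>y\<in>{e..1}.
        U x y = e + (1 - e) * S ((x - e) / (1 - e)) ((y - e) / (1 - e)))"

definition region_A :: "real \<Rightarrow> (real \<times> real) set" where
  "region_A e = {0..1} \<times> {0..1} - ({0..e} \<times> {0..e} \<union> {e..1} \<times> {e..1})"

definition locally_internal_on_A :: "real \<Rightarrow> (real \<Rightarrow> real \<Rightarrow> real) \<Rightarrow> bool" where
  "locally_internal_on_A e U \<longleftrightarrow> (\<forall>(x, y)\<in>region_A e. U x y \<in> {x, y})"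

definition distributive_over ::
  "(real \<Rightarrow> real \<Rightarrow> real) \<Rightarrow> (real \<Rightarrow> real \<Rightarrow> real) \<Rightarrow> bool" where
  "distributive_over V\<^sub>1 V\<^sub>2 \<longleftrightarrow>
     (\<forall>x\<in>{0..1}. \<forall>y\<in>{0..1}. \<forall>z\<in>{0..1}. V\<^sub>1 x (V\<^sub>2 y z) = V\<^sub>2 (V\<^sub>1 x y) (V\<^sub>1 x z))"

end

theory Submission
  imports Defs
begin

text \<open>
  Write \<open>a = e\<^sub>1\<close>, \<open>b = e\<^sub>2\<close>, \<open>U = U\<^sub>1\<close> and \<open>W = U\<^sub>2\<close>. The square \<open>[0,b]\<^sup>2\<close> is a stage of its own:
  there \<open>W\<close> is a rescaled copy of \<open>T\<^sub>2\<close>, and as soon as \<open>U b b = b\<close> the operation \<open>U\<close> restricts to it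
  and rescales to a uninorm with neutral element \<open>a / b\<close>. Condition (iii) therefore says exactly that
  \<open>U b b = b\<close> and that \<open>U\<close> distributes over \<open>W\<close> on \<open>[0,b]\<close> (lemma \<open>rescaled_uninorm_iff\<close>). What
  remains is the interaction with arguments above \<open>b\<close>, where \<open>W\<close> is the maximum.

  Suppose that \<open>U\<close> distributes over \<open>W\<close>. Expanding products \<open>U x (W y z)\<close> in which one of \<open>y\<close>, \<open>z\<close>
  is a neutral element yields the conditions one by one: first \<open>U b b = b\<close>, then \<open>U x b = x\<close> for
  \<open>x > b\<close>, then \<open>W x a = x\<close>. By monotonicity the last two give condition (ii). For \<open>x > b\<close> and
  \<open>y < a\<close> the expansions of \<open>U x (W b y)\<close> and of \<open>U y (W x a)\<close> show that \<open>u = U x y\<close> satisfies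
  \<open>u = W x u\<close> and \<open>u = W u y\<close>; together with internality of \<open>W\<close> these force \<open>u = W x y\<close>, and if
  \<open>u = y\<close> the second one says that \<open>y\<close> is an idempotent of \<open>W\<close>.

  Conversely, suppose that the three conditions hold. By commutativity only \<open>y \<le> z\<close> needs to be treated
  in \<open>U x (W y z)\<close>. Of two arguments on different sides of \<open>b\<close>, condition (i) says that \<open>U\<close> and \<open>W\<close>
  select the same one. An equation such as \<open>W y z = z\<close> can hence be read as \<open>U y z = z\<close>, and
  associativity of \<open>U\<close> transports it to \<open>U (U x y) z = U x z\<close>, which settles most cases. In the
  others both \<open>U x y\<close> and \<open>U x z\<close> are at most \<open>b\<close> although \<open>z > b\<close>. There \<open>W\<close> has to be idempotent
  at a value below \<open>b\<close>, which is what the second half of (i) provides.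
\<close>

section \<open>Uninorms\<close>

locale uninorm_op =
  fixes e :: real and U :: "real \<Rightarrow> real \<Rightarrow> real"
  assumes uninorm: "uninorm e U"
begin

lemma neutral_in_unit: "e \<in> {0..1}"
  using uninorm by (simp add: uninorm_def)

lemma in_unit: "x \<in> {0..1} \<Longrightarrow> y \<in> {0..1} \<Longrightarrow> U x y \<in> {0..1}"
  using uninorm unfolding uninorm_def by blast

lemma commute: "x \<in> {0..1} \<Longrightarrow> y \<in> {0..1} \<Longrightarrow> U x y = U y x"
  using uninorm unfolding uninorm_def by blast

lemma assoc:
  "x \<in> {0..1} \<Longrightarrow> y \<in> {0..1} \<Longrightarrow> z \<in> {0..1} \<Longrightarrow> U (U x y) z = U x (U y z)"
  using uninorm unfolding uninorm_def by blast

lemma left_neutral: "x \<in> {0..1} \<Longrightarrow> U e x = x"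
  and right_neutral: "x \<in> {0..1} \<Longrightarrow> U x e = x"
  using uninorm unfolding uninorm_def by blast+

lemma mono:
  assumes "x \<in> {0..1}" "x' \<in> {0..1}" "y \<in> {0..1}" "y' \<in> {0..1}" "x \<le> x'" "y \<le> y'"
  shows "U x y \<le> U x' y'"
proof -
  have "U x y \<le> U x' y" and "U x' y \<le> U x' y'"
    using uninorm assms unfolding uninorm_def by blast+
  then show ?thesis by (rule order_trans)
qed

lemma le_left: "x \<in> {0..1} \<Longrightarrow> y \<in> {0..1} \<Longrightarrow> y \<le> e \<Longrightarrow> U x y \<le> x"
  using mono[of x x y e] right_neutral[of x] neutral_in_unit by simp

lemma le_right: "x \<in> {0..1} \<Longrightarrow> y \<in> {0..1} \<Longrightarrow> x \<le> e \<Longrightarrow> U x y \<le> y"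
  using le_left[of y x] commute[of x y] by simp

lemma ge_left: "x \<in> {0..1} \<Longrightarrow> y \<in> {0..1} \<Longrightarrow> e \<le> y \<Longrightarrow> x \<le> U x y"
  using mono[of x x e y] right_neutral[of x] neutral_in_unit by simp

lemma ge_right: "x \<in> {0..1} \<Longrightarrow> y \<in> {0..1} \<Longrightarrow> e \<le> x \<Longrightarrow> y \<le> U x y"
  using ge_left[of y x] commute[of x y] by simp

end

section \<open>Two uninorms, the second one being the maximum above its neutral element\<close>

locale uninorm_pair = U: uninorm_op a U + W: uninorm_op b W
  for a U b W +
  assumes ab: "0 < a" "a < b" "b < 1"
    and W_max: "\<And>x y. x \<in> {b..1} \<Longrightarrow> y \<in> {b..1} \<Longrightarrow> W x y = max x y"
    and W_internal: "\<And>x y. x \<in> {b<..1} \<Longrightarrow> y \<in> {0..b} \<Longrightarrow> W x y \<in> {x, y}"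
begin

lemma a_unit: "a \<in> {0..1}" and b_unit: "b \<in> {0..1}"
  using ab by auto

lemma U_unit: "x \<in> {0..1} \<Longrightarrow> y \<in> {0..1} \<Longrightarrow> 0 \<le> U x y \<and> U x y \<le> 1"
  using U.in_unit[of x y] by simp

text \<open>
  Scaling by \<open>b\<close> carries \<open>[0,1]\<close> onto \<open>[0,b]\<close>, so the only question is whether \<open>U\<close> maps \<open>[0,b]\<^sup>2\<close> into
  \<open>[0,b]\<close>. By monotonicity that amounts to \<open>U b b \<le> b\<close>, and \<open>U b b \<ge> b\<close> always holds because \<open>a \<le> b\<close>.
\<close>

lemma rescaled_uninorm_iff:
  assumes W_T: "\<forall>x\<in>{0..b}. \<forall>y\<in>{0..b}. W x y = b * T (x / b) (y / b)"
  shows "(\<exists>V. uninorm (a / b) V \<and>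
            (\<forall>x\<in>{0..b}. \<forall>y\<in>{0..b}. U x y = b * V (x / b) (y / b)) \<and> distributive_over V T) \<longleftrightarrow>
         U b b = b \<and>
         (\<forall>x\<in>{0..b}. \<forall>y\<in>{0..b}. \<forall>z\<in>{0..b}. U x (W y z) = W (U x y) (U x z))"
    (is "?ex \<longleftrightarrow> ?restr")
proof
  note T = W_T[rule_format]
  assume ?ex
  then obtain V where V: "uninorm (a / b) V"
    and UV: "\<And>x y. x \<in> {0..b} \<Longrightarrow> y \<in> {0..b} \<Longrightarrow> U x y = b * V (x / b) (y / b)"
    and dist: "distributive_over V T"
    by blast
  interpret V: uninorm_op "a / b" V
    by unfold_locales (rule V)
  have scale: "x / b \<in> {0..1}" if "x \<in> {0..b}" for x
    using that ab by simp
  have closed: "U x y \<in> {0..b}" if "x \<in> {0..b}" "y \<in> {0..b}" for x y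
    using V.in_unit[OF scale scale, OF that] ab that by (simp add: UV mult_le_cancel_left2)
  have "b \<le> U b b"
    using U.ge_left[OF b_unit b_unit] ab by simp
  with closed[of b b] ab have "U b b = b"
    by simp
  moreover have "U x (W y z) = W (U x y) (U x z)"
    if x: "x \<in> {0..b}" and y: "y \<in> {0..b}" and z: "z \<in> {0..b}" for x y z
  proof -
    have W_closed: "W y z \<in> {0..b}"
      using W.in_unit[of y z] W.le_left[of y z] y z ab by simp
    have "V (x / b) (T (y / b) (z / b)) = T (V (x / b) (y / b)) (V (x / b) (z / b))"
      using dist scale[OF x] scale[OF y] scale[OF z] by (simp add: distributive_over_def)
    moreover have "W y z / b = T (y / b) (z / b)"
      using T[OF y z] ab by simp
    moreover have "U x y / b = V (x / b) (y / b)" "U x z / b = V (x / b) (z / b)"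
      using UV[OF x y] UV[OF x z] ab by simp_all
    ultimately show ?thesis
      using UV[OF x W_closed] T[OF closed closed, OF x y x z] by simp
  qed
  ultimately show ?restr
    by blast
next
  note T = W_T[rule_format]
  assume restr: ?restr
  define V where "V = (\<lambda>x y. U (b * x) (b * y) / b)"
  have scale: "b * x \<in> {0..1}" "b * x \<in> {0..b}" if "x \<in> {0..1}" for x
    using that ab mult_mono[of b 1 x 1] mult_left_mono[of x 1 b] by auto
  have closed: "U x y \<in> {0..b}" if "x \<in> {0..b}" "y \<in> {0..b}" for x y
    using U.mono[of x b y b] U.in_unit[of x y] restr that ab by simp
  have bV: "b * V x y = U (b * x) (b * y)" for x y
    using ab by (simp add: V_def)
  have V_neutral: "V (a / b) x = x" "V x (a / b) = x" if "x \<in> {0..1}" for x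
    using scale(1)[OF that] ab by (simp_all add: V_def U.left_neutral U.right_neutral)
  have V_unit: "V x y \<in> {0..1}" if "x \<in> {0..1}" "y \<in> {0..1}" for x y
    using closed[OF scale(2) scale(2), OF that] ab by (simp add: V_def)
  have "uninorm (a / b) V"
    unfolding uninorm_def
  proof (intro conjI ballI impI)
    fix x y z :: real
    assume xyz: "x \<in> {0..1}" "y \<in> {0..1}" "z \<in> {0..1}"
    have "b * V (V x y) z = b * V x (V y z)"
      using U.assoc[OF scale(1) scale(1) scale(1), OF xyz] by (simp add: bV)
    then show "V (V x y) z = V x (V y z)"
      using ab by simp
  qed (use ab V_unit V_neutral in \<open>auto simp: V_def
        intro!: U.commute U.mono scale mult_left_mono divide_right_mono\<close>)
  moreover have "U x y = b * V (x / b) (y / b)" for x y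
    using ab by (simp add: bV)
  moreover have "distributive_over V T"
    unfolding distributive_over_def
  proof (intro ballI)
    fix x y z :: real
    assume x: "x \<in> {0..1}" and y: "y \<in> {0..1}" and z: "z \<in> {0..1}"
    have bT: "b * T u v = W (b * u) (b * v)" if "u \<in> {0..1}" "v \<in> {0..1}" for u v
      using T[OF scale(2) scale(2), OF that] ab by simp
    have "b * V x (T y z) = b * T (V x y) (V x z)"
      using restr scale(2)[OF x] scale(2)[OF y] scale(2)[OF z]
      by (simp add: bV bT[OF y z] bT[OF V_unit V_unit, OF x y x z])
    then show "V x (T y z) = T (V x y) (V x z)"
      using ab by simp
  qed
  ultimately show ?ex
    by blast
qed

section \<open>Consequences of distributivity\<close>

text \<open>
  In this section a product \<open>U x (W y z)\<close> is expanded with \<open>y\<close> or \<open>z\<close> equal to \<open>a\<close> or \<open>b\<close>; the neutral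
  elements then remove one product, and what is left is a fixed point equation to which the maximum or
  internality applies.
\<close>

lemma dist_U_b_b:
  assumes "distributive_over U W"
  shows "U b b = b"
proof -
  have "U b (W b a) = W (U b b) (U b a)"
    using assms a_unit b_unit by (simp add: distributive_over_def)
  then have "b = W (U b b) b"
    using a_unit b_unit by (simp add: W.left_neutral U.right_neutral)
  then show ?thesis
    using U.in_unit[OF b_unit b_unit] by (simp add: W.right_neutral)
qed

lemma dist_U_b:
  assumes dist: "distributive_over U W" and x: "x \<in> {b<..1}"
  shows "U x b = x"
proof -
  have xu: "x \<in> {0..1}"
    using x ab by simp
  have "U x (W a b) = W (U x a) (U x b)"
    using dist xu a_unit b_unit by (simp add: distributive_over_def)
  then have "x = W x (U x b)"
    using xu a_unit by (simp add: W.right_neutral U.right_neutral)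
  moreover have "x \<le> U x b"
    using U.ge_left[OF xu b_unit] ab by simp
  ultimately show ?thesis
    using W_max[of x "U x b"] U_unit[OF xu b_unit] x by simp
qed

text \<open>
  The value \<open>W x a = a\<close> is excluded by multiplying with \<open>b\<close>: distributivity would turn it into
  \<open>b = W x b = x\<close>.
\<close>

lemma dist_W_a:
  assumes dist: "distributive_over U W" and x: "x \<in> {b<..1}"
  shows "W x a = x"
proof (rule ccontr)
  assume "W x a \<noteq> x"
  then have "W x a = a"
    using W_internal[OF x, of a] ab by simp
  have xu: "x \<in> {0..1}"
    using x ab by simp
  have "U b (W x a) = W (U b x) (U b a)"
    using dist xu a_unit b_unit by (simp add: distributive_over_def)
  then have "b = W x b"
    using \<open>W x a = a\<close> U.commute[OF b_unit xu] dist_U_b[OF dist x] U.right_neutral[OF b_unit] by simp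
  then show False
    using W.right_neutral[OF xu] x by simp
qed

lemma dist_above:
  assumes dist: "distributive_over U W" and x: "x \<in> {b<..1}" and y: "y \<in> {a..b}"
  shows "U x y = W x y" and "W x y = max x y"
proof -
  have u: "x \<in> {0..1}" "y \<in> {0..1}"
    using x y ab by simp_all
  have "U x y = x"
    using U.mono[of x x y b] U.ge_left[OF u] dist_U_b[OF dist x] u b_unit y by simp
  moreover have "W x y = x"
    using W.mono[of x x a y] W.le_left[OF u] dist_W_a[OF dist x] u a_unit y by simp
  ultimately show "U x y = W x y" and "W x y = max x y"
    using x y by simp_all
qed

text \<open>The equations \<open>u = W x u\<close> and \<open>u = W u y\<close> for \<open>u = U x y\<close>.\<close>

lemma dist_fixed_points:
  assumes dist: "distributive_over U W" and x: "x \<in> {b<..1}" and y: "y \<in> {0..b}"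
  shows "W x (U x y) = U x y" and "W (U x y) y = U x y"
proof -
  have u: "x \<in> {0..1}" "y \<in> {0..1}"
    using x y ab by simp_all
  have "U x (W b y) = W (U x b) (U x y)"
    using dist u b_unit by (simp add: distributive_over_def)
  then show "W x (U x y) = U x y"
    using u by (simp add: W.left_neutral dist_U_b[OF dist x])
  have "U y (W x a) = W (U y x) (U y a)"
    using dist u a_unit by (simp add: distributive_over_def)
  then show "W (U x y) y = U x y"
    using u U.commute[of y x] by (simp add: U.right_neutral dist_W_a[OF dist x])
qed

text \<open>
  Since \<open>y \<le> u \<le> x\<close> for \<open>u = U x y\<close> and \<open>y < a\<close>, the value \<open>W x y = x\<close> pushes \<open>u = W x u\<close> up to \<open>x\<close>.
  If \<open>W x y = y\<close>, then \<open>u \<le> b\<close> gives \<open>u = W u y \<le> y\<close>, while \<open>u > b\<close> would make \<open>u = W x u\<close> the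
  maximum \<open>x\<close>, and then \<open>u = W u y\<close> reads \<open>x = y\<close>.
\<close>

lemma dist_straddle:
  assumes dist: "distributive_over U W" and x: "x \<in> {b<..1}" and y: "y \<in> {0..b}"
  shows "U x y = W x y"
proof (cases "a \<le> y")
  case True
  then show ?thesis
    using dist_above(1)[OF dist x] y by simp
next
  case False
  have u: "x \<in> {0..1}" "y \<in> {0..1}"
    using x y ab by simp_all
  have Uu: "U x y \<in> {0..1}"
    by (rule U.in_unit[OF u])
  have "U x y \<le> x"
    using U.le_left[OF u] False by simp
  have "y \<le> U x y"
    using U.ge_right[OF u] x ab by simp
  note fixed = dist_fixed_points[OF dist x y]
  consider (top) "W x y = x" | (bottom) "W x y = y"
    using W_internal[OF x y] by blast
  then show ?thesis
  proof cases
    case top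
    then have "x \<le> W x (U x y)"
      using W.mono[of x x y "U x y"] u Uu \<open>y \<le> U x y\<close> by simp
    then show ?thesis
      using fixed(1) \<open>U x y \<le> x\<close> top by simp
  next
    case bottom
    show ?thesis
    proof (cases "U x y \<le> b")
      case True
      then have "U x y \<le> y"
        using W.le_right[OF Uu u(2)] fixed(2) by simp
      then show ?thesis
        using \<open>y \<le> U x y\<close> bottom by simp
    next
      case False
      then have "U x y = x"
        using fixed(1) W_max[of x "U x y"] x Uu \<open>U x y \<le> x\<close> by simp
      then show ?thesis
        using fixed(2) by simp
    qed
  qed
qed

lemma dist_idempotent:
  assumes dist: "distributive_over U W" and x: "x \<in> {b<..1}" and y: "y \<in> {0..b}"
    and "W x y = y"
  shows "W y y = y"
  using dist_fixed_points(2)[OF dist x y] dist_straddle[OF dist x y] \<open>W x y = y\<close> by simp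

section \<open>Distributivity from the three conditions\<close>

lemma distributive_if_conditions:
  assumes straddle: "\<forall>x\<in>{b<..1}. \<forall>y\<in>{0..b}. U x y = W x y"
    and idem: "\<forall>x\<in>{b<..1}. \<forall>y\<in>{0..a}. W x y = y \<longrightarrow> W y y = y"
    and above: "\<forall>x\<in>{b<..1}. \<forall>y\<in>{a..b}. W x y = max x y"
    and U_b_b: "U b b = b"
    and below: "\<forall>x\<in>{0..b}. \<forall>y\<in>{0..b}. \<forall>z\<in>{0..b}. U x (W y z) = W (U x y) (U x z)"
  shows "distributive_over U W"
proof -
  have UW: "U x y = W x y" "U y x = W x y" "W y x = W x y"
    if "x \<in> {b<..1}" "y \<in> {0..b}" for x y
    using straddle that U.commute[of y x] W.commute[of y x] ab by auto
  \<comment> \<open>Whenever \<open>W\<close> selects the lower of two arguments across \<open>b\<close>, the idempotence clause applies.\<close>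
  have bottom: "y < a \<and> W y y = y" if "x \<in> {b<..1}" "y \<in> {0..b}" "W x y = y" for x y
  proof -
    have "y < a"
    proof (rule ccontr)
      assume "\<not> y < a"
      then have "W x y = max x y"
        using above that by simp
      then show False
        using that by simp
    qed
    then show ?thesis
      using idem that by simp
  qed
  have closed: "U x y \<in> {0..b}" if "x \<in> {0..b}" "y \<in> {0..b}" for x y
    using U.mono[of x b y b] U.in_unit[of x y] U_b_b that ab by simp
  have eq: "U x (W y z) = W (U x y) (U x z)"
    if xyz: "x \<in> {0..1}" "y \<in> {0..1}" "z \<in> {0..1}" and yz: "y \<le> z" for x y z
  proof -
    \<comment> \<open>The letters place \<open>x\<close>, \<open>y\<close>, \<open>z\<close> in this order: \<open>L\<close> for at most \<open>b\<close>, \<open>H\<close> for above \<open>b\<close>.\<close>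
    consider
        (LLL) "x \<le> b" "z \<le> b" | (LLH) "x \<le> b" "y \<le> b" "b < z" | (LHH) "x \<le> b" "b < y"
      | (HLL) "b < x" "z \<le> b" | (HLH) "b < x" "y \<le> b" "b < z" | (HHH) "b < x" "b < y"
      by linarith
    then show ?thesis
    proof cases
      case LLL
      then show ?thesis
        using below xyz yz by simp
    next
      case LLH
      have x: "x \<in> {0..b}" and y: "y \<in> {0..b}" and z: "z \<in> {b<..1}"
        using LLH xyz by simp_all
      \<comment> \<open>Associativity of \<open>U\<close> gives the right-hand side as soon as \<open>U x z = z\<close>.\<close>
      have Uxyz: "W (U x y) z = U x (W y z)"
        using U.assoc[OF xyz] UW[OF z closed[OF x y]] UW[OF z y] by simp
      show ?thesis
      proof (cases "W z x = z")
        case True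
        then show ?thesis
          using Uxyz UW[OF z x] by simp
      next
        case False
        then have Wzx: "W z x = x"
          using W_internal[OF z x] by simp
        note x_bot = bottom[OF z x Wzx]
        consider "W z y = z" | "W z y = y"
          using W_internal[OF z y] by blast
        then show ?thesis
        proof cases
          case 1
          have "U x y = U (U x z) y"
            using UW[OF z x] Wzx by simp
          also have "\<dots> = U x (U z y)"
            using U.assoc xyz by simp
          also have "\<dots> = x"
            using 1 UW[OF z y] UW[OF z x] Wzx by simp
          finally show ?thesis
            using 1 UW[OF z y] UW[OF z x] Wzx x_bot by simp
        next
          case 2
          let ?p = "U x y"
          have p: "?p \<in> {0..b}" "?p \<in> {0..1}"
            using closed[OF x y] ab by auto
          have "W z ?p = ?p"
            using Uxyz 2 UW[OF z y] UW[OF z p(1)] by simp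
          then have pp: "W ?p ?p = ?p"
            using bottom[OF z p(1)] by simp
          have "?p \<le> x"
            using U.le_left[of x y] xyz bottom[OF z y 2] by simp
          \<comment> \<open>The idempotent \<open>U x y\<close> lies below \<open>x \<le> b\<close>, so \<open>W\<close> acts on the two as the minimum.\<close>
          then have "W ?p x = ?p"
            using W.mono[of ?p ?p ?p x] W.le_left[of ?p x] pp p xyz LLH by simp
          then show ?thesis
            using 2 UW[OF z y] UW[OF z x] Wzx by simp
        qed
      qed
    next
      case LHH
      have x: "x \<in> {0..b}" and y: "y \<in> {b<..1}" and z: "z \<in> {b<..1}"
        using LHH xyz yz by simp_all
      have Wyz: "W y z = z"
        using W_max[of y z] y z yz by simp
      have "W y x \<le> W z x"
        using W.mono[of y z x x] xyz yz by simp
      then consider "W y x = y" "W z x = z" | "W y x = x" "W z x = z" | "W y x = x" "W z x = x"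
        using W_internal[OF y x] W_internal[OF z x] LHH by force
      then show ?thesis
      proof cases
        case 1
        then show ?thesis
          using UW[OF y x] UW[OF z x] Wyz by simp
      next
        case 2
        then show ?thesis
          using UW[OF y x] UW[OF z x] Wyz by simp
      next
        case 3
        then show ?thesis
          using UW[OF y x] UW[OF z x] Wyz bottom[OF z x] by simp
      qed
    next
      case HLL
      have x: "x \<in> {b<..1}" and y: "y \<in> {0..b}" and z: "z \<in> {0..b}"
        using HLL xyz yz by simp_all
      have u: "W y z \<in> {0..b}" "W x z \<in> {0..1}" "W y z \<in> {0..1}"
        using W.le_left[of y z] W.in_unit[of y z] W.in_unit[of x z] xyz z y by simp_all
      \<comment> \<open>Multiplication by \<open>x\<close> agrees with \<open>W x\<close> on \<open>[0,b]\<close>, and it distributes because \<open>x\<close> is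
          an idempotent of the commutative semigroup \<open>W\<close>.\<close>
      have "W (W x y) (W x z) = W x (W (W y x) z)"
        using xyz u W.in_unit[of y x] by (simp add: W.assoc)
      also have "\<dots> = W (W x x) (W y z)"
        using xyz u UW(3)[OF x y] by (simp add: W.assoc)
      also have "\<dots> = W x (W y z)"
        using W_max[of x x] x by simp
      finally show ?thesis
        using UW[OF x y] UW[OF x z] UW[OF x u(1)] by simp
    next
      case HLH
      have x: "x \<in> {b<..1}" and y: "y \<in> {0..b}" and z: "z \<in> {b<..1}"
        using HLH xyz yz by simp_all
      let ?t = "U x z"
      have ge: "x \<le> ?t" "z \<le> ?t"
        using U.ge_left[of x z] U.ge_right[of x z] xyz HLH ab by simp_all
      have t: "?t \<in> {b<..1}" "?t \<in> {0..1}"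
        using ge HLH U_unit[of x z] xyz by simp_all
      have Wxt: "W x ?t = ?t"
        using W_max[of x ?t] x t ge by simp
      consider (zx) "W z y = z" "W x y = x" | (zy) "W z y = z" "W x y = y"
        | (yx) "W z y = y" "W x y = x" | (yy) "W z y = y" "W x y = y"
        using W_internal[OF z y] W_internal[OF x y] by blast
      then show ?thesis
      proof cases
        case zx
        then show ?thesis
          using UW[OF z y] UW[OF x y] Wxt by simp
      next
        case zy
        have "z \<le> W ?t y"
          using W.mono[of z ?t y y] zy ge xyz t by simp
        then have "W ?t y = ?t"
          using W_internal[OF t(1) y] HLH by auto
        then show ?thesis
          using zy UW[OF z y] UW[OF x y] UW[OF t(1) y] by simp
      next
        case yx
        have "U x z = U (U x y) z"
          using yx UW[OF x y] by simp
        also have "\<dots> = x"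
          using yx U.assoc[OF xyz] UW[OF z y] UW[OF x y] by simp
        finally show ?thesis
          using yx UW[OF z y] UW[OF x y] W_max[of x x] x by simp
      next
        case yy
        have "W ?t y = U (U y x) z"
          using UW[OF t(1) y] U.assoc[of y x z] xyz by simp
        also have "\<dots> = y"
          using yy UW[OF x y] UW[OF z y] by simp
        finally show ?thesis
          using yy UW[OF z y] UW[OF x y] UW[OF t(1) y] by simp
      qed
    next
      case HHH
      have "U x y \<le> U x z"
        using U.mono[of x x y z] xyz yz by simp
      moreover have "x \<le> U x y" "x \<le> U x z"
        using U.ge_left[of x y] U.ge_left[of x z] xyz yz HHH ab by simp_all
      ultimately show ?thesis
        using W_max[of y z] W_max[of "U x y" "U x z"] U_unit[of x y] U_unit[of x z] xyz yz HHH by simp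
    qed
  qed
  show ?thesis
    unfolding distributive_over_def
  proof (intro ballI)
    fix x y z :: real
    assume xyz: "x \<in> {0..1}" "y \<in> {0..1}" "z \<in> {0..1}"
    show "U x (W y z) = W (U x y) (U x z)"
    proof (cases "y \<le> z")
      case True
      then show ?thesis
        using eq xyz by simp
    next
      case False
      have "U x (W z y) = W (U x z) (U x y)"
        using eq[of x z y] xyz False by simp
      then show ?thesis
        using W.commute[of y z] W.commute[OF U.in_unit U.in_unit, of x y x z] xyz by simp
    qed
  qed
qed

end

theorem theorem3:
  fixes e\<^sub>1 e\<^sub>2 :: real
    and U\<^sub>1 U\<^sub>2 T\<^sub>1 T\<^sub>2 S\<^sub>1 :: "real \<Rightarrow> real \<Rightarrow> real"
  assumes "0 < e\<^sub>1" and "e\<^sub>1 < e\<^sub>2" and "e\<^sub>2 < 1"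
    and "uninorm_with U\<^sub>1 T\<^sub>1 e\<^sub>1 S\<^sub>1"
    and "uninorm_with U\<^sub>2 T\<^sub>2 e\<^sub>2 max"
    and "locally_internal_on_A e\<^sub>2 U\<^sub>2"
  shows "distributive_over U\<^sub>1 U\<^sub>2 \<longleftrightarrow>
    ((\<forall>x\<in>{e\<^sub>2<..1}. \<forall>y\<in>{0..e\<^sub>2}. U\<^sub>1 x y = U\<^sub>2 x y \<and> U\<^sub>2 x y \<in> {x, y}) \<and>
     (\<forall>x\<^sub>0\<in>{e\<^sub>2<..1}. \<forall>y\<^sub>0\<in>{0..e\<^sub>1}. U\<^sub>2 x\<^sub>0 y\<^sub>0 = y\<^sub>0 \<longrightarrow> U\<^sub>2 y\<^sub>0 y\<^sub>0 = y\<^sub>0)) \<and>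
    (\<forall>x\<in>{e\<^sub>2<..1}. \<forall>y\<in>{e\<^sub>1..e\<^sub>2}. U\<^sub>1 x y = U\<^sub>2 x y \<and> U\<^sub>2 x y = max x y) \<and>
    (\<exists>V. uninorm (e\<^sub>1 / e\<^sub>2) V \<and>
         (\<forall>x\<in>{0..e\<^sub>2}. \<forall>y\<in>{0..e\<^sub>2}. U\<^sub>1 x y = e\<^sub>2 * V (x / e\<^sub>2) (y / e\<^sub>2)) \<and>
         distributive_over V T\<^sub>2)"
proof -
  interpret W: uninorm_op e\<^sub>2 U\<^sub>2
    using assms by unfold_locales (simp add: uninorm_with_def)
  have T: "\<forall>x\<in>{0..e\<^sub>2}. \<forall>y\<in>{0..e\<^sub>2}. U\<^sub>2 x y = e\<^sub>2 * T\<^sub>2 (x / e\<^sub>2) (y / e\<^sub>2)"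
    using assms(5) unfolding uninorm_with_def by blast
  interpret uninorm_pair e\<^sub>1 U\<^sub>1 e\<^sub>2 U\<^sub>2
  proof unfold_locales
    show "uninorm e\<^sub>1 U\<^sub>1"
      using assms(4) by (simp add: uninorm_with_def)
    show "U\<^sub>2 x y = max x y" if "x \<in> {e\<^sub>2..1}" "y \<in> {e\<^sub>2..1}" for x y
    proof -
      have "U\<^sub>2 x y = e\<^sub>2 + (1 - e\<^sub>2) * max ((x - e\<^sub>2) / (1 - e\<^sub>2)) ((y - e\<^sub>2) / (1 - e\<^sub>2))"
        using assms(5) that unfolding uninorm_with_def by blast
      also have "\<dots> = max x y"
        using assms(3) by (simp add: max_def divide_le_cancel)
      finally show ?thesis .
    qed
    show "U\<^sub>2 x y \<in> {x, y}" if "x \<in> {e\<^sub>2<..1}" "y \<in> {0..e\<^sub>2}" for x y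
    proof (cases "y = e\<^sub>2")
      case True
      then show ?thesis
        using W.right_neutral[of x] that assms(1-3) by simp
    next
      case False
      then have "(x, y) \<in> region_A e\<^sub>2"
        using that assms(1-3) by (auto simp: region_A_def)
      then show ?thesis
        using assms(6) by (auto simp: locally_internal_on_A_def)
    qed
  qed (use assms in auto)
  show ?thesis
    unfolding rescaled_uninorm_iff[OF T]
  proof
    assume dist: "distributive_over U\<^sub>1 U\<^sub>2"
    have "U\<^sub>1 x (U\<^sub>2 y z) = U\<^sub>2 (U\<^sub>1 x y) (U\<^sub>1 x z)"
      if "x \<in> {0..e\<^sub>2}" "y \<in> {0..e\<^sub>2}" "z \<in> {0..e\<^sub>2}" for x y z
      using dist that assms(3) by (simp add: distributive_over_def)
    moreover have "U\<^sub>2 y y = y" if "x \<in> {e\<^sub>2<..1}" "y \<in> {0..e\<^sub>1}" "U\<^sub>2 x y = y" for x y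
      using dist_idempotent[OF dist that(1) _ that(3)] that(2) assms(2) by simp
    ultimately
    show "((\<forall>x\<in>{e\<^sub>2<..1}. \<forall>y\<in>{0..e\<^sub>2}. U\<^sub>1 x y = U\<^sub>2 x y \<and> U\<^sub>2 x y \<in> {x, y}) \<and>
       (\<forall>x\<^sub>0\<in>{e\<^sub>2<..1}. \<forall>y\<^sub>0\<in>{0..e\<^sub>1}. U\<^sub>2 x\<^sub>0 y\<^sub>0 = y\<^sub>0 \<longrightarrow> U\<^sub>2 y\<^sub>0 y\<^sub>0 = y\<^sub>0)) \<and>
      (\<forall>x\<in>{e\<^sub>2<..1}. \<forall>y\<in>{e\<^sub>1..e\<^sub>2}. U\<^sub>1 x y = U\<^sub>2 x y \<and> U\<^sub>2 x y = max x y) \<and>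
      U\<^sub>1 e\<^sub>2 e\<^sub>2 = e\<^sub>2 \<and>
      (\<forall>x\<in>{0..e\<^sub>2}. \<forall>y\<in>{0..e\<^sub>2}. \<forall>z\<in>{0..e\<^sub>2}. U\<^sub>1 x (U\<^sub>2 y z) = U\<^sub>2 (U\<^sub>1 x y) (U\<^sub>1 x z))"
      using dist_U_b_b[OF dist] dist_above[OF dist] dist_straddle[OF dist] W_internal by blast
  qed (rule distributive_if_conditions, auto)
qed

end
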